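(* Let $m\ge 1$, $\mathcal N=\{1,\dots,m\}$, and let $\Theta\subseteq\mathbb R^p$ be nonempty, closed and convex. Assume that $h$ is strongly convex over $\Theta$ with constant $\kappa>0$ and that $\|\nabla h(\theta^a)-\nabla h(\theta^b)\|\le R_\theta\|\theta^a-\theta^b\|$ for all $\theta^a,\theta^b\in\Theta$. Let the sequences $\{\theta_i^k\}_{k\ge0}$, $i\in\mathcal N$, be generated by the learning recursion $$\theta_i^{k+1}=\Pi_\Theta\big(\theta_i^k-\gamma_k(\nabla h(\theta_i^k)+\beta_i^k)\big),\qquad \beta_i^k=\nabla_\theta g(\theta_i^k,\chi_i^k)-\nabla h(\theta_i^k),$$ within the algorithm described in the context, where the errors of the algorithm satisfy, for all $k\ge 0$ and $i\in\mathcal N$: (a) $\mathbb E[w_i^k\mid\mathcal F_k]=0$ and $\mathbb E[\beta_i^k\mid\mathcal F_k]=0$; (b) $\mathbb E[\|w_i^k\|^2\mid\mathcal F_k]\le\nu^2$ and $\mathbb E[\|\beta_i^k\|^2\mid\mathcal F_k]\le\nu_\theta^2$; (c) $\mathbb E[\|\theta_i^0\|^2]<\infty$. Assume the stepsizes $\gamma_k>0$ satisfy $\sum_{k=0}^\infty\gamma_k=\infty$ and $\sum_{k=0}^\infty\gamma_k^2<\infty$. Let $\theta^*=\operatorname{argmin}_{\theta\in\Theta}h(\theta)$. Then, almost surely, $\theta_i^k\to\theta^*$ as $k\to\infty$ for every $i=1,\dots,m$.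
   Context: Setting. There are $m$ agents. Agent $i$ has a closed convex set $X_i\subseteq\mathbb R^n$ and a function $f_i(x,\theta)=\mathbb E[\varphi_i(x,\theta,\xi)]$, where $\varphi_i:\mathbb R^n\times\mathbb R^p\times\mathbb R^d\to\mathbb R$ is convex and continuously differentiable in $x$ and $\nabla_x f_i(x,\theta)=\mathbb E[\nabla_x\varphi_i(x,\theta,\xi)]$. All agents share the learning function $h(\theta)=\mathbb E[g(\theta,\chi)]$, where $g:\mathbb R^p\times\mathbb R^r\to\mathbb R$ is strongly convex and continuously differentiable in $\theta$ for every value of $\chi$, and $\nabla h(\theta)=\mathbb E[\nabla_\theta g(\theta,\chi)]$. $\Pi_Y$ denotes Euclidean projection onto the closed convex set $Y$, and $\|\cdot\|$ is the Euclidean norm. Algorithm. With random initial points $x_i^0\in X_i$, $\theta_i^0\in\Theta$, nonnegative weights $a_i^{j,k}$ with $\sum_{j=1}^m a_i^{j,k}=1$, and stepsizes $\alpha_k,\gamma_k>0$, for all $i\in\mathcal N$ and $k\ge 0$: $$v_i^k=\sum_{j=1}^m a_i^{j,k}x_j^k,\quad x_i^{k+1}=\Pi_{X_i}\big(v_i^k-\alpha_k(\nabla_x f_i(v_i^k,\theta_i^k)+w_i^k)\big),\quad \theta_i^{k+1}=\Pi_\Theta\big(\theta_i^k-\gamma_k(\nabla h(\theta_i^k)+\beta_i^k)\big),$$ where $w_i^k=\nabla_x\varphi_i(v_i^k,\theta_i^k,\xi_i^k)-\nabla_x f_i(v_i^k,\theta_i^k)$, $\beta_i^k=\nabla_\theta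 g(\theta_i^k,\chi_i^k)-\nabla h(\theta_i^k)$, and $\xi_i^k,\chi_i^k$ are the random samples used by agent $i$ at iteration $k$. $\mathcal F_0$ is the $\sigma$-algebra generated by the initial points $(x_i^0,\theta_i^0)$, $i\in\mathcal N$, and for $k\ge1$, $\mathcal F_k$ is the $\sigma$-algebra generated by the initial points together with $(\xi_i^t,\chi_i^t)$, $i\in\mathcal N$, $0\le t\le k-1$. *)

theory Defs
  imports "HOL-Probability.Probability"
begin

definition gradient :: "('a::real_inner \<Rightarrow> real) \<Rightarrow> 'a \<Rightarrow> 'a" where
  "gradient f x = (THE D. GDERIV f x :> D)"

definition continuously_differentiable :: "('a::real_inner \<Rightarrow> real) \<Rightarrow> bool" where
  "continuously_differentiable f \<longleftrightarrow>
     (\<forall>x. f differentiable (at x)) \<and> continuous_on UNIV (gradient f)"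

(* Normalised so that x \<mapsto> (\<kappa>/2) * (norm x)^2 has modulus \<kappa>; for differentiable f this is the
   convention under which the gradient is \<kappa>-strongly monotone. *)
definition strongly_convex_on :: "'a::real_inner set \<Rightarrow> real \<Rightarrow> ('a \<Rightarrow> real) \<Rightarrow> bool" where
  "strongly_convex_on S \<kappa> f \<longleftrightarrow> convex S \<and>
     (\<forall>x\<in>S. \<forall>y\<in>S. \<forall>u\<ge>0. \<forall>v\<ge>0. u + v = 1 \<longrightarrow>
        f (u *\<^sub>R x + v *\<^sub>R y) \<le> u * f x + v * f y - \<kappa> / 2 * u * v * (norm (x - y))\<^sup>2)"

(* Componentwise; like real_cond_exp, meaningful only for integrable Z. *)
definition vec_cond_exp ::
    "'w measure \<Rightarrow> 'w measure \<Rightarrow> ('w \<Rightarrow> real ^ 'n) \<Rightarrow> 'w \<Rightarrow> real ^ 'n" where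
  "vec_cond_exp M F Z \<omega> = (\<chi> j. real_cond_exp M F (\<lambda>\<omega>. Z \<omega> $ j) \<omega>)"

(* x0, th0: initial points; xs i t, cs i t: samples drawn by agent i at iteration t.
   For k = 0 the last two families are empty. *)
definition history_algebra ::
    "'w measure \<Rightarrow> nat set \<Rightarrow>
     (nat \<Rightarrow> 'w \<Rightarrow> 'a::topological_space) \<Rightarrow> (nat \<Rightarrow> 'w \<Rightarrow> 'b::topological_space) \<Rightarrow>
     (nat \<Rightarrow> nat \<Rightarrow> 'w \<Rightarrow> 'c::topological_space) \<Rightarrow> (nat \<Rightarrow> nat \<Rightarrow> 'w \<Rightarrow> 'd::topological_space) \<Rightarrow>
     nat \<Rightarrow> 'w measure" where
  "history_algebra M N x0 th0 xs cs k = sigma (space M)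
     ({x0 i -` A \<inter> space M | i A. i \<in> N \<and> A \<in> sets borel} \<union>
      {th0 i -` A \<inter> space M | i A. i \<in> N \<and> A \<in> sets borel} \<union>
      {xs i t -` A \<inter> space M | i t A. i \<in> N \<and> t < k \<and> A \<in> sets borel} \<union>
      {cs i t -` A \<inter> space M | i t A. i \<in> N \<and> t < k \<and> A \<in> sets borel})"

end

theory Submission
  imports Defs
begin

text \<open>
  The proof follows the squared distance \<open>V k = (norm (\<theta> i k - \<theta>star))\<^sup>2\<close> of one agent. The minimizer is
  a fixed point of the noise-free projected gradient step, projection does not increase distances,
  and the gradient of \<open>h\<close> is strongly monotone and Lipschitz on \<open>\<Theta>\<close>. Together with the
  conditional mean and variance of the noise this gives, for every event \<open>B\<close> of the history
  up to time \<open>k\<close>,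
  \<open>\<integral>\<^sub>B V (k+1) \<le> (1 - 2 * \<kappa> * \<gamma> k + R\<^sub>\<theta>\<^sup>2 * (\<gamma> k)\<^sup>2) * \<integral>\<^sub>B V k + \<nu>\<^sub>\<theta>\<^sup>2 * (\<gamma> k)\<^sup>2 * P B\<close>
  (lemma \<open>projected_stochastic_gradient_AE_tendsto\<close>).

  Because the squares of the \<open>\<gamma> k\<close> are summable, a rescaling and a shift by the tail of their sum
  turn \<open>V\<close> into a nonnegative supermartingale \<open>S\<close>. Because the \<open>\<gamma> k\<close> themselves are not summable,
  the drift forces the expectation of \<open>S k\<close> to zero
  (lemma \<open>stochastic_approximation_AE_tendsto_zero\<close>).

  Once the expectation tends to zero, the maximal inequality for nonnegative supermartingales, started at later and
  later times, yields \<open>S k \<longlonglongrightarrow> 0\<close> almost surely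
  (lemmas \<open>nonneg_supermartingale_maximal_inequality\<close> and \<open>nonneg_supermartingale_AE_tendsto_zero\<close>).

  Two preparations make the argument applicable. The choice operator in \<open>arg_min_on\<close> returns a minimizer
  because strong convexity confines the search to a compact set (lemma \<open>strongly_convex_on_arg_min\<close>).
  The iterates are adapted to the history because a gradient is a limit of difference
  quotients and hence jointly measurable in the parameter and the sample
  (lemma \<open>borel_measurable_gradient\<close>).
\<close>

section \<open>Gradients of strongly convex functions\<close>

lemma gradient_eqI:
  assumes "GDERIV f x :> D"
  shows "gradient f x = D"
  unfolding gradient_def
proof (rule the_equality)
  show "GDERIV f x :> D" by fact
next
  fix E assume "GDERIV f x :> E"
  with assms have "(\<lambda>v. v \<bullet> E) = (\<lambda>v. v \<bullet> D)"
    unfolding gderiv_def by (rule has_derivative_unique[symmetric])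
  then show "E = D"
    by (metis inner_commute vector_eq_rdot)
qed

text \<open>
  In finite dimension every linear functional is an inner product with a fixed vector, so
  Frechet differentiability alone provides a gradient.
\<close>

lemma GDERIV_gradient:
  fixes f :: "'a::euclidean_space \<Rightarrow> real"
  assumes "f differentiable (at x)"
  shows "GDERIV f x :> gradient f x"
proof -
  obtain f' where f': "(f has_derivative f') (at x)"
    using assms by (auto simp: differentiable_def)
  then have lin: "linear f'"
    by (rule has_derivative_linear)
  have "f' = (\<lambda>v. v \<bullet> (\<Sum>b\<in>Basis. f' b *\<^sub>R b))"
  proof
    fix v
    have "f' v = f' (\<Sum>b\<in>Basis. (v \<bullet> b) *\<^sub>R b)"
      by (simp add: euclidean_representation)
    also have "\<dots> = (\<Sum>b\<in>Basis. (v \<bullet> b) * f' b)"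
      using lin by (simp add: linear_sum linear_scale)
    also have "\<dots> = v \<bullet> (\<Sum>b\<in>Basis. f' b *\<^sub>R b)"
      by (simp add: inner_sum_right mult.commute)
    finally show "f' v = v \<bullet> (\<Sum>b\<in>Basis. f' b *\<^sub>R b)" .
  qed
  then have "GDERIV f x :> (\<Sum>b\<in>Basis. f' b *\<^sub>R b)"
    using f' unfolding gderiv_def by metis
  then show ?thesis
    using gradient_eqI by metis
qed

lemma GDERIV_difference_quotient:
  assumes "GDERIV f x :> D"
  shows "((\<lambda>t. (f (x + t *\<^sub>R d) - f x) / t) \<longlongrightarrow> d \<bullet> D) (at 0)"
proof -
  have "((\<lambda>t::real. x + t *\<^sub>R d) has_derivative (\<lambda>t. t *\<^sub>R d)) (at 0)"
    by (auto intro!: derivative_eq_intros)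
  moreover have "(f has_derivative (\<lambda>v. v \<bullet> D)) (at (x + 0 *\<^sub>R d))"
    using assms by (simp add: gderiv_def)
  ultimately have "((\<lambda>t. f (x + t *\<^sub>R d)) has_derivative (\<lambda>t. (t *\<^sub>R d) \<bullet> D)) (at 0)"
    by (rule has_derivative_compose)
  then have "((\<lambda>t. f (x + t *\<^sub>R d)) has_real_derivative (d \<bullet> D)) (at 0)"
    by (simp add: has_field_derivative_def mult_commute_abs)
  then show ?thesis
    by (simp add: DERIV_def)
qed

text \<open>
  Rearranged, strong convexity along the segment from \<open>x\<close> to \<open>y\<close> bounds the difference quotient
  of \<open>f\<close> at \<open>x\<close> by the increment \<open>f y - f x\<close> minus a quadratic term. Letting the step
  tend to zero from the right turns the quotient into the directional derivative.
\<close>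

lemma strongly_convex_on_first_order:
  assumes sc: "strongly_convex_on S \<kappa> f" and D: "GDERIV f x :> D"
    and x: "x \<in> S" and y: "y \<in> S"
  shows "f x + (y - x) \<bullet> D + \<kappa> / 2 * (norm (y - x))\<^sup>2 \<le> f y"
proof -
  define c where "c = (norm (y - x))\<^sup>2"
  have lim: "((\<lambda>t. (f (x + t *\<^sub>R (y - x)) - f x) / t) \<longlongrightarrow> (y - x) \<bullet> D) (at_right 0)"
    using GDERIV_difference_quotient[OF D] by (rule filterlim_mono) (auto simp: at_within_le_at)
  have lim': "((\<lambda>t. f y - f x - \<kappa> / 2 * (1 - t) * c) \<longlongrightarrow> f y - f x - \<kappa> / 2 * (1 - 0) * c) (at_right 0)"
    by (intro tendsto_intros)
  have bound: "(f (x + t *\<^sub>R (y - x)) - f x) / t \<le> f y - f x - \<kappa> / 2 * (1 - t) * c"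
    if t: "0 < t" "t < 1" for t :: real
  proof -
    have "f ((1 - t) *\<^sub>R x + t *\<^sub>R y) \<le> (1 - t) * f x + t * f y - \<kappa> / 2 * (1 - t) * t * (norm (x - y))\<^sup>2"
      using sc t x y unfolding strongly_convex_on_def by auto
    moreover have "(1 - t) *\<^sub>R x + t *\<^sub>R y = x + t *\<^sub>R (y - x)"
      by (simp add: algebra_simps)
    ultimately have "f (x + t *\<^sub>R (y - x)) - f x \<le> t * (f y - f x - \<kappa> / 2 * (1 - t) * c)"
      by (simp add: c_def norm_minus_commute algebra_simps)
    then show ?thesis
      using t by (simp add: divide_le_eq mult.commute)
  qed
  have "\<forall>\<^sub>F t in at_right 0. (f (x + t *\<^sub>R (y - x)) - f x) / t \<le> f y - f x - \<kappa> / 2 * (1 - t) * c"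
    using eventually_at_right_real[of 0 1] by (rule eventually_mono[OF _ bound]) auto
  from tendsto_le[OF _ lim' lim this] show ?thesis
    by (simp add: c_def)
qed

text \<open>
  Add the first-order inequality from \<open>x\<close> to \<open>y\<close> to the one from \<open>y\<close> to \<open>x\<close>: the function
  values cancel and the two quadratic terms combine.
\<close>

lemma strongly_convex_on_gradient_monotone:
  assumes sc: "strongly_convex_on S \<kappa> f"
    and "GDERIV f x :> D" "GDERIV f y :> E" "x \<in> S" "y \<in> S"
  shows "\<kappa> * (norm (x - y))\<^sup>2 \<le> (x - y) \<bullet> (D - E)"
  using strongly_convex_on_first_order[OF sc assms(2,4,5)]
    strongly_convex_on_first_order[OF sc assms(3,5,4)]
  by (simp add: norm_minus_commute inner_diff algebra_simps)

lemma minimizer_variational_inequality: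
  assumes "convex S" and D: "GDERIV f x :> D" and x: "x \<in> S" and y: "y \<in> S"
    and min: "\<And>z. z \<in> S \<Longrightarrow> f x \<le> f z"
  shows "0 \<le> (y - x) \<bullet> D"
proof (rule tendsto_lowerbound)
  show "((\<lambda>t. (f (x + t *\<^sub>R (y - x)) - f x) / t) \<longlongrightarrow> (y - x) \<bullet> D) (at_right 0)"
    using GDERIV_difference_quotient[OF D] by (rule filterlim_mono) (auto simp: at_within_le_at)
  have "0 \<le> (f (x + t *\<^sub>R (y - x)) - f x) / t" if "0 < t" "t < 1" for t :: real
  proof -
    have "(1 - t) *\<^sub>R x + t *\<^sub>R y \<in> S"
      using \<open>convex S\<close> x y that by (intro convexD) auto
    moreover have "(1 - t) *\<^sub>R x + t *\<^sub>R y = x + t *\<^sub>R (y - x)"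
      by (simp add: algebra_simps)
    ultimately show ?thesis
      using min that by simp
  qed
  then show "\<forall>\<^sub>F t in at_right 0. 0 \<le> (f (x + t *\<^sub>R (y - x)) - f x) / t"
    using eventually_at_right_real[of 0 1] by (auto elim!: eventually_mono)
qed simp

text \<open>
  The constant \<open>arg_min_on\<close> is a choice operator and says nothing until a minimizer is known to
  exist. Fix \<open>a\<close> in \<open>S\<close>. Outside the ball of radius \<open>2 * norm (G a) / \<kappa>\<close> around \<open>a\<close>, the
  quadratic term of the first-order inequality outweighs the linear one, so \<open>f\<close> is at least
  \<open>f a\<close> there; inside that ball compactness gives a minimizer.
\<close>

lemma strongly_convex_on_arg_min:
  fixes S :: "'a::euclidean_space set"
  assumes sc: "strongly_convex_on S \<kappa> f" and "\<kappa> > 0" and "closed S" "S \<noteq> {}"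
    and G: "\<And>x. GDERIV f x :> G x"
  shows "arg_min_on f S \<in> S" and "y \<in> S \<Longrightarrow> f (arg_min_on f S) \<le> f y"
proof -
  obtain a where a: "a \<in> S"
    using \<open>S \<noteq> {}\<close> by auto
  define r where "r = 2 * norm (G a) / \<kappa>"
  have "compact (S \<inter> cball a r)"
    using \<open>closed S\<close> by (simp add: closed_Int_compact)
  moreover have "S \<inter> cball a r \<noteq> {}"
    using a \<open>\<kappa> > 0\<close> by (auto simp: r_def intro!: exI[of _ a])
  moreover have "continuous_on (S \<inter> cball a r) f"
    using G by (auto simp: gderiv_def intro!: continuous_at_imp_continuous_on has_derivative_continuous)
  ultimately obtain b where b: "b \<in> S \<inter> cball a r" "\<And>y. y \<in> S \<inter> cball a r \<Longrightarrow> f b \<le> f y"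
    using continuous_attains_inf by metis
  have "f b \<le> f y" if y: "y \<in> S" for y
  proof (cases "y \<in> cball a r")
    case False
    then have far: "2 * norm (G a) < \<kappa> * norm (y - a)"
      using \<open>\<kappa> > 0\<close> by (simp add: r_def dist_norm norm_minus_commute field_simps)
    have "norm (y - a) * (2 * norm (G a)) \<le> norm (y - a) * (\<kappa> * norm (y - a))"
      using far by (intro mult_left_mono) auto
    moreover have "- (norm (y - a) * norm (G a)) \<le> (y - a) \<bullet> G a"
      using Cauchy_Schwarz_ineq2[of "y - a" "G a"] by linarith
    ultimately have "f a \<le> f y"
      using strongly_convex_on_first_order[OF sc G a y] by (simp add: power2_eq_square algebra_simps)
    moreover have "f b \<le> f a"
      using a \<open>\<kappa> > 0\<close> by (intro b) (auto simp: r_def)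
    ultimately show ?thesis by simp
  qed (use b y in auto)
  then have "is_arg_min f (\<lambda>x. x \<in> S) b"
    using b by (auto simp: is_arg_min_linorder)
  then have "is_arg_min f (\<lambda>x. x \<in> S) (arg_min_on f S)"
    unfolding arg_min_on_def arg_min_def by (rule someI)
  then show "arg_min_on f S \<in> S" and "y \<in> S \<Longrightarrow> f (arg_min_on f S) \<le> f y"
    by (auto simp: is_arg_min_linorder)
qed

section \<open>Projected gradient steps\<close>

text \<open>
  The first-order optimality condition makes the angle at \<open>x\<close> between \<open>- D\<close> and every direction
  into \<open>S\<close> non-acute, so no point of \<open>S\<close> is nearer to \<open>x - \<gamma> *\<^sub>R D\<close> than \<open>x\<close> is. Hence a minimizer
  over \<open>S\<close> is left in place by a noise-free step of any length.
\<close>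

lemma projected_gradient_fixed_point:
  fixes S :: "'a::euclidean_space set"
  assumes "convex S" "closed S" "x \<in> S" "0 \<le> \<gamma>"
    and vi: "\<And>y. y \<in> S \<Longrightarrow> 0 \<le> (y - x) \<bullet> D"
  shows "closest_point S (x - \<gamma> *\<^sub>R D) = x"
proof (rule closest_point_unique[symmetric])
  show "\<forall>y\<in>S. dist (x - \<gamma> *\<^sub>R D) x \<le> dist (x - \<gamma> *\<^sub>R D) y"
  proof
    fix y assume "y \<in> S"
    then have "0 \<le> \<gamma> * ((y - x) \<bullet> D)"
      using vi \<open>0 \<le> \<gamma>\<close> by simp
    then have "(norm (\<gamma> *\<^sub>R D))\<^sup>2 \<le> (norm (\<gamma> *\<^sub>R D + (y - x)))\<^sup>2"
      unfolding power2_norm_eq_inner by (simp add: inner_add inner_commute)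
    then have "norm (\<gamma> *\<^sub>R D) \<le> norm (\<gamma> *\<^sub>R D + (y - x))"
      by (simp add: power2_le_iff_abs_le)
    also have "\<dots> = dist (x - \<gamma> *\<^sub>R D) y"
      unfolding dist_norm by (subst norm_minus_commute) (simp add: algebra_simps)
    finally show "dist (x - \<gamma> *\<^sub>R D) x \<le> dist (x - \<gamma> *\<^sub>R D) y"
      by (simp add: dist_norm)
  qed
qed (use assms in auto)

text \<open>
  In the expansion of the square, monotonicity controls the cross term and the Lipschitz bound
  the term of second order in the step length.
\<close>

lemma gradient_step_contraction:
  fixes x y D E :: "'a::real_inner"
  assumes mono: "\<kappa> * (norm (x - y))\<^sup>2 \<le> (x - y) \<bullet> (D - E)"
    and Lip: "norm (D - E) \<le> R * norm (x - y)" and "0 \<le> \<gamma>"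
  shows "(norm ((x - y) - \<gamma> *\<^sub>R (D - E)))\<^sup>2 \<le> (1 - 2 * \<kappa> * \<gamma> + R\<^sup>2 * \<gamma>\<^sup>2) * (norm (x - y))\<^sup>2"
proof -
  have "(norm (D - E))\<^sup>2 \<le> (R * norm (x - y))\<^sup>2"
    using Lip by (rule power_mono) simp
  then have "\<gamma>\<^sup>2 * (norm (D - E))\<^sup>2 \<le> \<gamma>\<^sup>2 * (R\<^sup>2 * (norm (x - y))\<^sup>2)"
    by (intro mult_left_mono) (auto simp: power_mult_distrib)
  moreover have "\<gamma> * (\<kappa> * (norm (x - y))\<^sup>2) \<le> \<gamma> * ((x - y) \<bullet> (D - E))"
    using mono \<open>0 \<le> \<gamma>\<close> by (rule mult_left_mono)
  moreover have "(norm ((x - y) - \<gamma> *\<^sub>R (D - E)))\<^sup>2 =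
      (norm (x - y))\<^sup>2 - 2 * (\<gamma> * ((x - y) \<bullet> (D - E))) + \<gamma>\<^sup>2 * (norm (D - E))\<^sup>2"
    unfolding power2_norm_eq_inner
    by (simp only: inner_diff_left[of "x - y"] inner_diff_right[of _ "x - y"])
       (simp add: inner_commute power2_eq_square)
  ultimately show ?thesis
    by (simp add: algebra_simps)
qed

section \<open>Measurability of gradients\<close>

text \<open>
  Every component of the gradient is a pointwise limit of difference quotients along the steps
  \<open>1 / Suc n\<close>, and these are jointly measurable because \<open>g\<close> is. The joint statement allows a
  random argument and a random sample to be substituted at the same time.
\<close>

lemma borel_measurable_gradient:
  fixes g :: "'a::euclidean_space \<Rightarrow> 'c::second_countable_topology \<Rightarrow> real"
  assumes meas: "(\<lambda>(t, c). g t c) \<in> borel_measurable borel"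
    and diff: "\<And>t c. (\<lambda>t. g t c) differentiable (at t)"
  shows "(\<lambda>(t, c). gradient (\<lambda>t. g t c) t) \<in> borel_measurable borel"
proof (rule borel_measurable_euclidean_space[THEN iffD2], rule ballI)
  fix b :: 'a assume "b \<in> Basis"
  define q where "q n = (\<lambda>(t, c). (g (t + inverse (real (Suc n)) *\<^sub>R b) c - g t c) / inverse (real (Suc n)))" for n
  have [measurable]: "(\<lambda>(t, c). g t c) \<in> borel_measurable (borel \<Otimes>\<^sub>M borel)"
    using meas by (simp add: borel_prod)
  have "q n \<in> borel_measurable borel" for n
  proof -
    have "(\<lambda>p. (\<lambda>(t, c). g t c) (fst p + inverse (real (Suc n)) *\<^sub>R b, snd p)) \<in> borel_measurable (borel \<Otimes>\<^sub>M borel)"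
      by (rule measurable_compose[OF _ \<open>(\<lambda>(t, c). g t c) \<in> borel_measurable (borel \<Otimes>\<^sub>M borel)\<close>]) measurable
    then have "q n \<in> borel_measurable (borel \<Otimes>\<^sub>M borel)"
      unfolding q_def by (simp add: split_beta')
    then show ?thesis
      by (simp add: borel_prod)
  qed
  moreover have "(\<lambda>n. q n p) \<longlonglongrightarrow> (\<lambda>(t, c). gradient (\<lambda>t. g t c) t) p \<bullet> b" for p
  proof -
    obtain t c where p: "p = (t, c)"
      by (cases p)
    have "filterlim (\<lambda>n. inverse (real (Suc n))) (at 0) sequentially"
      by (intro filterlim_atI LIMSEQ_inverse_real_of_nat) auto
    from filterlim_compose[OF GDERIV_difference_quotient[OF GDERIV_gradient[OF diff]] this]
    show ?thesis
      by (simp add: p q_def inner_commute)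
  qed
  ultimately show "(\<lambda>x. (\<lambda>(t, c). gradient (\<lambda>t. g t c) t) x \<bullet> b) \<in> borel_measurable borel"
    by (rule borel_measurable_LIMSEQ_metric)
qed

section \<open>Nonnegative supermartingales with vanishing expectation\<close>

text \<open>
  Follow \<open>S\<close> from time \<open>n\<close> until it first reaches the level \<open>\<epsilon>\<close> and discard the paths that have
  reached it. The integral of \<open>S\<close> over the surviving event does not grow in time, since that event
  belongs to the history; and discarding paths removes from the integral at least \<open>\<epsilon>\<close> times their
  probability. So \<open>\<epsilon>\<close> times the discarded mass never exceeds the initial expectation.

  The supermartingale property is expressed by integrals over events of the history because
  a drift estimate is available directly in that form.
\<close>

lemma (in prob_space) nonneg_supermartingale_maximal_inequality:
  fixes S :: "nat \<Rightarrow> 'a \<Rightarrow> real"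
  assumes sub: "\<And>k. subalgebra M (F k)" and mono: "\<And>k. sets (F k) \<subseteq> sets (F (Suc k))"
    and adapted: "\<And>k. S k \<in> borel_measurable (F k)"
    and nonneg: "\<And>k \<omega>. \<omega> \<in> space M \<Longrightarrow> 0 \<le> S k \<omega>"
    and int: "\<And>k. integrable M (S k)"
    and super: "\<And>k B. B \<in> sets (F k) \<Longrightarrow> (LINT \<omega>:B|M. S (Suc k) \<omega>) \<le> (LINT \<omega>:B|M. S k \<omega>)"
  shows "\<epsilon> * prob {\<omega> \<in> space M. \<exists>j\<ge>n. \<epsilon> \<le> S j \<omega>} \<le> expectation (S n)"
proof -
  \<comment> \<open>The event that the level has not been reached at the times \<open>n, \<dots>, n + d - 1\<close>; \<open>B (Suc d)\<close> is known at time \<open>n + d\<close>.\<close>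
  define B where "B d = {\<omega> \<in> space M. \<forall>j<d. S (n + j) \<omega> < \<epsilon>}" for d
  have space_F: "space (F k) = space M" and sets_F: "sets (F k) \<subseteq> sets M" for k
    using sub by (auto simp: subalgebra_def)
  have B_Suc: "B (Suc d) = B d \<inter> {\<omega> \<in> space (F (n + d)). S (n + d) \<omega> < \<epsilon>}" for d
    unfolding B_def space_F by (auto simp: less_Suc_eq)
  have B_step: "B (Suc d) \<in> sets (F (n + d))" if "B d \<in> sets (F (n + d))" for d
    unfolding B_Suc using that adapted by (intro sets.Int) (auto intro: borel_measurable_less)
  have B_F: "B d \<in> sets (F (n + d))" for d
  proof (induction d)
    case 0
    then show ?case using sets.top[of "F n"] by (simp add: B_def space_F)
  next
    case (Suc d)
    then show ?case using B_step mono by fastforce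
  qed
  then have B_M [measurable]: "B d \<in> sets M" for d
    using sets_F by blast
  have B_decr: "B (Suc d) \<subseteq> B d" for d
    unfolding B_Suc by auto
  have set_int: "set_integrable M A (S k)" if "A \<in> sets M" for A k
    unfolding set_integrable_def using int that by (intro integrable_mult_indicator)
  have bound: "(LINT \<omega>:B d|M. S (n + d) \<omega>) + \<epsilon> * prob (space M - B d) \<le> expectation (S n)" for d
  proof (induction d)
    case 0
    have "B 0 = space M" by (auto simp: B_def)
    then show ?case using int by (simp add: set_integral_space)
  next
    case (Suc d)
    let ?D = "B d - B (Suc d)"
    have "(LINT \<omega>:B (Suc d)|M. S (n + Suc d) \<omega>) \<le> (LINT \<omega>:B (Suc d)|M. S (n + d) \<omega>)"
      using super[OF B_step[OF B_F]] by simp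
    moreover have "\<epsilon> * prob ?D \<le> (LINT \<omega>:?D|M. S (n + d) \<omega>)"
    proof -
      have "(LINT \<omega>:?D|M. \<epsilon>) \<le> (LINT \<omega>:?D|M. S (n + d) \<omega>)"
      proof (rule set_integral_mono)
        show "set_integrable M ?D (\<lambda>\<omega>. \<epsilon>)"
          unfolding set_integrable_def by (intro integrable_mult_indicator) auto
        show "\<epsilon> \<le> S (n + d) \<omega>" if "\<omega> \<in> ?D" for \<omega>
          using that by (auto simp: B_def less_Suc_eq not_less)
      qed (auto intro: set_int)
      then show ?thesis
        by (simp add: set_lebesgue_integral_def mult.commute)
    qed
    moreover have "(LINT \<omega>:B d|M. S (n + d) \<omega>) =
        (LINT \<omega>:B (Suc d)|M. S (n + d) \<omega>) + (LINT \<omega>:?D|M. S (n + d) \<omega>)"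
    proof -
      have "B d = B (Suc d) \<union> ?D" using B_decr[of d] by auto
      then have "(LINT \<omega>:B d|M. S (n + d) \<omega>) = (LINT \<omega>:B (Suc d) \<union> ?D|M. S (n + d) \<omega>)" by simp
      also have "\<dots> = (LINT \<omega>:B (Suc d)|M. S (n + d) \<omega>) + (LINT \<omega>:?D|M. S (n + d) \<omega>)"
        by (intro set_integral_Un set_int) auto
      finally show ?thesis .
    qed
    moreover have "prob (space M - B (Suc d)) = prob (space M - B d) + prob ?D"
    proof -
      have "space M - B (Suc d) = (space M - B d) \<union> ?D"
        using B_decr[of d] sets.sets_into_space[OF B_M[of d]] by auto
      moreover have "prob \<dots> = prob (space M - B d) + prob ?D"
        by (rule finite_measure_Union) auto
      ultimately show ?thesis by simp
    qed
    ultimately show ?case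
      using Suc.IH by (simp add: distrib_left)
  qed
  have *: "\<epsilon> * prob (space M - B d) \<le> expectation (S n)" for d
  proof -
    have "0 \<le> (LINT \<omega>:B d|M. S (n + d) \<omega>)"
      unfolding set_lebesgue_integral_def
      by (rule integral_nonneg_AE) (auto simp: nonneg)
    then show ?thesis using bound[of d] by linarith
  qed
  have "(\<Union>d. space M - B d) = {\<omega> \<in> space M. \<exists>j\<ge>n. \<epsilon> \<le> S j \<omega>}"
  proof safe
    fix \<omega> j assume w: "\<omega> \<in> space M" "n \<le> j" "\<epsilon> \<le> S j \<omega>"
    then have "\<omega> \<in> space M - B (Suc (j - n))"
      by (auto simp: B_def intro!: exI[of _ "j - n"])
    then show "\<omega> \<in> (\<Union>d. space M - B d)" by blast
  qed (auto simp: B_def not_less intro: le_add1)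
  moreover have "(\<lambda>d. prob (space M - B d)) \<longlonglongrightarrow> prob (\<Union>d. space M - B d)"
    using B_decr by (intro finite_Lim_measure_incseq) (auto intro!: incseq_SucI)
  ultimately have "(\<lambda>d. \<epsilon> * prob (space M - B d)) \<longlonglongrightarrow> \<epsilon> * prob {\<omega> \<in> space M. \<exists>j\<ge>n. \<epsilon> \<le> S j \<omega>}"
    by (intro tendsto_mult_left) simp
  then show ?thesis
    using * by (intro LIMSEQ_le_const2) auto
qed

text \<open>
  The probability of reaching \<open>\<epsilon>\<close> infinitely often is at most the probability of reaching it
  from time \<open>n\<close> on, hence at most \<open>expectation (S n) / \<epsilon>\<close> for every \<open>n\<close>, hence zero. Countably many
  levels \<open>\<epsilon>\<close> suffice.
\<close>

lemma (in prob_space) nonneg_supermartingale_AE_tendsto_zero: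
  fixes S :: "nat \<Rightarrow> 'a \<Rightarrow> real"
  assumes sub: "\<And>k. subalgebra M (F k)" and mono: "\<And>k. sets (F k) \<subseteq> sets (F (Suc k))"
    and adapted: "\<And>k. S k \<in> borel_measurable (F k)"
    and nonneg: "\<And>k \<omega>. \<omega> \<in> space M \<Longrightarrow> 0 \<le> S k \<omega>"
    and int: "\<And>k. integrable M (S k)"
    and super: "\<And>k B. B \<in> sets (F k) \<Longrightarrow> (LINT \<omega>:B|M. S (Suc k) \<omega>) \<le> (LINT \<omega>:B|M. S k \<omega>)"
    and lim: "(\<lambda>k. expectation (S k)) \<longlonglongrightarrow> 0"
  shows "AE \<omega> in M. (\<lambda>k. S k \<omega>) \<longlonglongrightarrow> 0"
proof -
  define H where "H \<epsilon> = {\<omega> \<in> space M. \<forall>n. \<exists>j\<ge>n. \<epsilon> \<le> S j \<omega>}" for \<epsilon>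
  have [measurable]: "S k \<in> borel_measurable M" for k
    using int by auto
  have "AE \<omega> in M. \<omega> \<notin> H \<epsilon>" if "0 < \<epsilon>" for \<epsilon>
  proof -
    have H_M [measurable]: "H \<epsilon> \<in> sets M"
      unfolding H_def by measurable
    have "\<epsilon> * prob (H \<epsilon>) \<le> expectation (S n)" for n
    proof -
      have "prob (H \<epsilon>) \<le> prob {\<omega> \<in> space M. \<exists>j\<ge>n. \<epsilon> \<le> S j \<omega>}"
        by (rule finite_measure_mono) (auto simp: H_def)
      then have "\<epsilon> * prob (H \<epsilon>) \<le> \<epsilon> * prob {\<omega> \<in> space M. \<exists>j\<ge>n. \<epsilon> \<le> S j \<omega>}"
        using that by (intro mult_left_mono) auto
      also have "\<dots> \<le> expectation (S n)"
        by (rule nonneg_supermartingale_maximal_inequality[where F = F and S = S, OF sub mono adapted nonneg int super])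
      finally show ?thesis .
    qed
    then have "\<epsilon> * prob (H \<epsilon>) \<le> 0"
      using lim by (intro LIMSEQ_le_const) auto
    then have "prob (H \<epsilon>) = 0"
      using that by (simp add: mult_le_0_iff measure_le_0_iff)
    then show ?thesis
      using prob_eq_0[of "H \<epsilon>"] by simp
  qed
  then have "AE \<omega> in M. \<forall>q. \<omega> \<notin> H (inverse (real (Suc q)))"
    by (subst AE_all_countable) simp
  then show ?thesis
  proof (rule AE_mp, intro AE_I2 impI)
    fix \<omega> assume w: "\<omega> \<in> space M" and notH: "\<forall>q. \<omega> \<notin> H (inverse (real (Suc q)))"
    show "(\<lambda>k. S k \<omega>) \<longlonglongrightarrow> 0"
    proof (rule LIMSEQ_I)
      fix r :: real assume "0 < r"
      then obtain q where q: "inverse (real (Suc q)) < r"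
        using reals_Archimedean by blast
      obtain n where n: "\<forall>j\<ge>n. S j \<omega> < inverse (real (Suc q))"
        using spec[OF notH, of q] w unfolding H_def mem_Collect_eq by (metis not_le)
      then show "\<exists>n. \<forall>k\<ge>n. norm (S k \<omega> - 0) < r"
      proof (intro exI[of _ n] allI impI)
        fix k assume "n \<le> k"
        then have "S k \<omega> < r" using n q order.strict_trans by blast
        then show "norm (S k \<omega> - 0) < r" using nonneg[OF w, of k] by simp
      qed
    qed
  qed
qed

section \<open>Recursions of Robbins-Monro type\<close>

text \<open>
  The growth factors \<open>1 + b * (\<gamma> j)\<^sup>2\<close> have a finite product and the noise terms
  \<open>c * (\<gamma> j)\<^sup>2\<close> a finite sum. Dividing \<open>V k\<close> by the product \<open>p k\<close> of the factors used so far, and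
  adding \<open>c\<close> times the sum \<open>T k\<close> of the squares still to come, removes both effects: the result \<open>S k\<close>
  is a nonnegative supermartingale. Its expectation even drops by at least a fixed multiple of
  \<open>\<gamma> k * expectation (V k)\<close> in each step. If the expectations stayed above some \<open>L > 0\<close>, then
  \<open>expectation (V k)\<close> would be at least \<open>L / 2\<close> from some time on, and since the \<open>\<gamma> k\<close> have an
  infinite sum the expectation of \<open>S k\<close> would eventually be negative. So the expectation of \<open>S k\<close>
  tends to zero, and almost sure convergence follows from the maximal inequality.
\<close>

lemma (in prob_space) stochastic_approximation_AE_tendsto_zero:
  fixes V :: "nat \<Rightarrow> 'a \<Rightarrow> real" and \<gamma> :: "nat \<Rightarrow> real"
  assumes sub: "\<And>k. subalgebra M (F k)" and mono: "\<And>k. sets (F k) \<subseteq> sets (F (Suc k))"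
    and adapted: "\<And>k. V k \<in> borel_measurable (F k)"
    and nonneg: "\<And>k \<omega>. \<omega> \<in> space M \<Longrightarrow> 0 \<le> V k \<omega>"
    and int: "\<And>k. integrable M (V k)"
    and const: "0 < a" "0 \<le> b" "0 \<le> c"
    and drift: "\<And>k B. B \<in> sets (F k) \<Longrightarrow> (LINT \<omega>:B|M. V (Suc k) \<omega>) \<le>
        (1 - a * \<gamma> k + b * (\<gamma> k)\<^sup>2) * (LINT \<omega>:B|M. V k \<omega>) + c * (\<gamma> k)\<^sup>2 * prob B"
    and gamma: "\<And>k. 0 \<le> \<gamma> k" "filterlim (\<lambda>n. \<Sum>k<n. \<gamma> k) at_top sequentially"
      "summable (\<lambda>k. (\<gamma> k)\<^sup>2)"
  shows "AE \<omega> in M. (\<lambda>k. V k \<omega>) \<longlonglongrightarrow> 0"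
proof -
  define p where "p k = (\<Prod>j<k. 1 + b * (\<gamma> j)\<^sup>2)" for k
  define P where "P = exp (b * (\<Sum>j. (\<gamma> j)\<^sup>2))"
  define T where "T k = (\<Sum>j. (\<gamma> j)\<^sup>2) - (\<Sum>j<k. (\<gamma> j)\<^sup>2)" for k
  define S where "S k \<omega> = V k \<omega> / p k + c * T k" for k \<omega>
  have p_ge1: "1 \<le> p k" for k
    unfolding p_def using const by (intro prod_ge_1) auto
  have p_le: "p k \<le> P" for k
  proof -
    have "p k \<le> (\<Prod>j<k. exp (b * (\<gamma> j)\<^sup>2))"
      unfolding p_def using const by (intro prod_mono) (auto simp: add_nonneg_nonneg)
    also have "\<dots> = exp (b * (\<Sum>j<k. (\<gamma> j)\<^sup>2))"
      by (simp add: exp_sum sum_distrib_left)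
    also have "\<dots> \<le> P"
      unfolding P_def using const gamma(3) by (auto intro!: mult_left_mono sum_le_suminf)
    finally show ?thesis .
  qed
  have P_pos: "0 < P" by (simp add: P_def)
  have T_nonneg: "0 \<le> T k" for k
    unfolding T_def using sum_le_suminf[OF gamma(3), of "{..<k}"] by simp
  have T_lim: "T \<longlonglongrightarrow> 0"
    unfolding T_def using tendsto_diff[OF tendsto_const[of "\<Sum>j. (\<gamma> j)\<^sup>2"] summable_LIMSEQ[OF gamma(3)]]
    by simp
  have sets_F: "sets (F k) \<subseteq> sets M" and space_F: "space (F k) = space M" for k
    using sub by (auto simp: subalgebra_def)
  have set_int: "set_integrable M B (V k)" if "B \<in> sets M" for B k
    unfolding set_integrable_def using int that by (intro integrable_mult_indicator)
  have S_int: "integrable M (S k)" for k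
    unfolding S_def using int by auto
  have S_integral: "(LINT \<omega>:B|M. S k \<omega>) = (LINT \<omega>:B|M. V k \<omega>) / p k + c * T k * prob B"
    if "B \<in> sets M" for B k
  proof -
    have "set_integrable M B (\<lambda>\<omega>. c * T k)"
      unfolding set_integrable_def using that by (intro integrable_mult_indicator) auto
    from set_integral_add(2)[OF set_integrable_divide[OF set_int[OF that]] this]
    have "(LINT \<omega>:B|M. S k \<omega>) = (LINT \<omega>:B|M. V k \<omega> / p k) + (LINT \<omega>:B|M. c * T k)"
      unfolding S_def .
    then show ?thesis
      using that by (simp add: set_lebesgue_integral_def mult.commute)
  qed
  have V_set_nonneg: "0 \<le> (LINT \<omega>:B|M. V k \<omega>)" for B k
    unfolding set_lebesgue_integral_def by (rule integral_nonneg_AE) (auto simp: nonneg)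
  have S_drift: "(LINT \<omega>:B|M. S (Suc k) \<omega>) + a / P * \<gamma> k * (LINT \<omega>:B|M. V k \<omega>) \<le> (LINT \<omega>:B|M. S k \<omega>)"
    if B: "B \<in> sets (F k)" for k B
  proof -
    let ?v = "LINT \<omega>:B|M. V k \<omega>" and ?v' = "LINT \<omega>:B|M. V (Suc k) \<omega>"
    have p_Suc: "p (Suc k) = p k * (1 + b * (\<gamma> k)\<^sup>2)"
      by (simp add: p_def)
    have q_pos: "0 < 1 + b * (\<gamma> k)\<^sup>2"
      using const by (simp add: add_pos_nonneg)
    have "?v' \<le> (1 + b * (\<gamma> k)\<^sup>2) * ?v - a * \<gamma> k * ?v + c * (\<gamma> k)\<^sup>2 * prob B"
      using drift[OF B] by (simp add: algebra_simps)
    then have "?v' / p (Suc k) \<le> ((1 + b * (\<gamma> k)\<^sup>2) * ?v - a * \<gamma> k * ?v + c * (\<gamma> k)\<^sup>2 * prob B) / p (Suc k)"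
      using p_ge1[of "Suc k"] by (intro divide_right_mono) auto
    also have "\<dots> = (1 + b * (\<gamma> k)\<^sup>2) * ?v / p (Suc k) - a * \<gamma> k * ?v / p (Suc k) + c * (\<gamma> k)\<^sup>2 * prob B / p (Suc k)"
      by (simp add: add_divide_distrib diff_divide_distrib)
    also have "(1 + b * (\<gamma> k)\<^sup>2) * ?v / p (Suc k) = ?v / p k"
      using q_pos by (simp add: p_Suc)
    finally have "?v' / p (Suc k) \<le> ?v / p k - a * \<gamma> k * ?v / p (Suc k) + c * (\<gamma> k)\<^sup>2 * prob B / p (Suc k)" .
    moreover have "a * \<gamma> k * ?v / P \<le> a * \<gamma> k * ?v / p (Suc k)"
      using const gamma(1)[of k] V_set_nonneg[of B k] p_le[of "Suc k"] p_ge1[of "Suc k"]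
      by (intro divide_left_mono mult_nonneg_nonneg mult_pos_pos P_pos) auto
    moreover have "c * (\<gamma> k)\<^sup>2 * prob B / p (Suc k) \<le> c * (\<gamma> k)\<^sup>2 * prob B / 1"
      using const p_ge1[of "Suc k"] by (intro divide_left_mono) auto
    moreover have "c * T (Suc k) * prob B = c * T k * prob B - c * (\<gamma> k)\<^sup>2 * prob B"
      by (simp add: T_def algebra_simps)
    moreover have "B \<in> sets M" using B sets_F by auto
    ultimately show ?thesis
      by (simp add: S_integral)
  qed
  have super: "(LINT \<omega>:B|M. S (Suc k) \<omega>) \<le> (LINT \<omega>:B|M. S k \<omega>)" if "B \<in> sets (F k)" for k B
  proof -
    have "0 \<le> a / P * \<gamma> k * (LINT \<omega>:B|M. V k \<omega>)"
      using const P_pos gamma(1)[of k] V_set_nonneg[of B k] by simp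
    then show ?thesis using S_drift[OF that] by linarith
  qed
  have S_nonneg: "0 \<le> S k \<omega>" if "\<omega> \<in> space M" for k \<omega>
    unfolding S_def using nonneg[OF that, of k] p_ge1[of k] T_nonneg[of k] const by simp
  have E_S: "expectation (S k) = expectation (V k) / p k + c * T k" for k
    using S_integral[of "space M" k] int S_int by (simp add: set_integral_space prob_space)
  have E_drift: "expectation (S (Suc k)) + a / P * \<gamma> k * expectation (V k) \<le> expectation (S k)" for k
    using S_drift[of "space M" k] sets.top[of "F k"] int S_int by (simp add: set_integral_space space_F)
  have E_nonneg: "0 \<le> expectation (S k)" "0 \<le> expectation (V k)" for k
    using S_nonneg nonneg by (auto intro!: integral_nonneg_AE)
  have E_decr: "decseq (\<lambda>k. expectation (S k))"
  proof (rule decseq_SucI)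
    fix k
    have "0 \<le> a / P * \<gamma> k * expectation (V k)"
      using const P_pos gamma(1)[of k] E_nonneg(2)[of k] by simp
    then show "expectation (S (Suc k)) \<le> expectation (S k)" using E_drift[of k] by linarith
  qed
  then obtain L where L: "(\<lambda>k. expectation (S k)) \<longlonglongrightarrow> L" "\<And>k. L \<le> expectation (S k)"
    using decseq_convergent[OF E_decr, of 0] E_nonneg by blast
  have "0 \<le> L"
    using L(1) E_nonneg by (intro LIMSEQ_le_const) auto
  moreover have "\<not> 0 < L"
  proof
    assume "0 < L"
    have "(\<lambda>k. c * T k) \<longlonglongrightarrow> c * 0"
      by (intro tendsto_intros T_lim)
    then have "\<forall>\<^sub>F k in sequentially. c * T k < L / 2"
      using \<open>0 < L\<close> by (intro order_tendstoD) auto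
    then obtain K where K: "\<And>k. K \<le> k \<Longrightarrow> c * T k < L / 2"
      by (auto simp: eventually_sequentially)
    define \<delta> where "\<delta> = a / P * (L / 2)"
    have "0 < \<delta>" using const P_pos \<open>0 < L\<close> by (simp add: \<delta>_def)
    have V_ge: "L / 2 \<le> expectation (V k)" if "K \<le> k" for k
    proof -
      have "expectation (V k) / p k \<le> expectation (V k) / 1"
        using p_ge1[of k] E_nonneg by (intro divide_left_mono) auto
      then show ?thesis using L(2)[of k] K[OF that] E_S[of k] by simp
    qed
    have descent: "expectation (S n) + \<delta> * (\<Sum>k<n. \<gamma> k) \<le> expectation (S K) + \<delta> * (\<Sum>k<K. \<gamma> k)"
      if "K \<le> n" for n
      using that
    proof (induction n rule: dec_induct)
      case (step n)
      have "\<delta> * \<gamma> n \<le> a / P * \<gamma> n * expectation (V n)"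
        using mult_left_mono[OF V_ge[OF step.hyps(1)], of "a / P * \<gamma> n"] const P_pos gamma(1)[of n]
        by (simp add: \<delta>_def mult.commute mult.left_commute)
      then show ?case
        using step.IH E_drift[of n] by (simp add: distrib_left)
    qed simp
    have "\<forall>\<^sub>F n in sequentially. (expectation (S K) + \<delta> * (\<Sum>k<K. \<gamma> k)) / \<delta> < (\<Sum>k<n. \<gamma> k) \<and> K \<le> n"
      using gamma(2) by (intro eventually_conj eventually_ge_at_top) (simp add: filterlim_at_top_dense)
    then obtain n where n: "(expectation (S K) + \<delta> * (\<Sum>k<K. \<gamma> k)) / \<delta> < (\<Sum>k<n. \<gamma> k)" "K \<le> n"
      by (auto simp: eventually_sequentially)
    then have "expectation (S K) + \<delta> * (\<Sum>k<K. \<gamma> k) < \<delta> * (\<Sum>k<n. \<gamma> k)"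
      using \<open>0 < \<delta>\<close> by (simp add: divide_less_eq mult.commute)
    then show False
      using descent[OF n(2)] E_nonneg(1)[of n] by linarith
  qed
  ultimately have "L = 0" by simp
  have "S k \<in> borel_measurable (F k)" for k
    unfolding S_def using adapted by measurable
  from nonneg_supermartingale_AE_tendsto_zero[OF sub mono this S_nonneg S_int super L(1)[unfolded \<open>L = 0\<close>]]
  have "AE \<omega> in M. (\<lambda>k. S k \<omega>) \<longlonglongrightarrow> 0" .
  then show ?thesis
  proof (rule AE_mp, intro AE_I2 impI)
    fix \<omega> assume w: "\<omega> \<in> space M" and lim: "(\<lambda>k. S k \<omega>) \<longlonglongrightarrow> 0"
    have "V k \<omega> \<le> P * S k \<omega>" for k
    proof -
      have "V k \<omega> = p k * (V k \<omega> / p k)" using p_ge1[of k] by simp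
      also have "\<dots> \<le> P * (V k \<omega> / p k)"
        using p_le[of k] p_ge1[of k] nonneg[OF w, of k] by (intro mult_right_mono) auto
      also have "\<dots> \<le> P * S k \<omega>"
        using P_pos const T_nonneg[of k] by (intro mult_left_mono) (auto simp: S_def)
      finally show ?thesis .
    qed
    moreover have "(\<lambda>k. P * S k \<omega>) \<longlonglongrightarrow> 0"
      using tendsto_mult_left[OF lim, of P] by simp
    ultimately show "(\<lambda>k. V k \<omega>) \<longlonglongrightarrow> 0"
      using nonneg[OF w]
      by (intro tendsto_sandwich[of "\<lambda>k. 0" "\<lambda>k. V k \<omega>" sequentially "\<lambda>k. P * S k \<omega>"])
         (simp_all add: always_eventually)
  qed
qed

section \<open>Conditional moments and integrals over events\<close>

text \<open>
  This makes the cross term between the noise and the current position vanish. Square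
  integrability of both factors is what makes the products of components integrable, so that
  \<open>Y\<close> may be taken out of the conditional expectation.
\<close>

lemma (in sigma_finite_subalgebra) integral_inner_vec_cond_exp_zero:
  fixes Y Z :: "'a \<Rightarrow> real ^ 'n"
  assumes Y [measurable]: "Y \<in> borel_measurable F" and Z [measurable]: "Z \<in> borel_measurable M"
    and int: "integrable M (\<lambda>\<omega>. (norm (Y \<omega>))\<^sup>2)" "integrable M (\<lambda>\<omega>. (norm (Z \<omega>))\<^sup>2)"
    and mean: "AE \<omega> in M. vec_cond_exp M F Z \<omega> = 0"
  shows "integrable M (\<lambda>\<omega>. Y \<omega> \<bullet> Z \<omega>)" and "(\<integral>\<omega>. Y \<omega> \<bullet> Z \<omega> \<partial>M) = 0"
proof -
  have Y_M [measurable]: "Y \<in> borel_measurable M"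
    by (rule measurable_from_subalg[OF subalg Y])
  have nth: "(\<lambda>v :: real ^ 'n. v $ j) \<in> borel_measurable borel" for j
    by (intro borel_measurable_continuous_onI continuous_intros)
  have comp: "(\<lambda>\<omega>. Y \<omega> $ j) \<in> borel_measurable F" "(\<lambda>\<omega>. Y \<omega> $ j) \<in> borel_measurable M"
    "(\<lambda>\<omega>. Z \<omega> $ j) \<in> borel_measurable M" for j
    using measurable_compose[OF Y nth] measurable_compose[OF Y_M nth] measurable_compose[OF Z nth] by auto
  have int_j: "integrable M (\<lambda>\<omega>. Y \<omega> $ j * Z \<omega> $ j)" for j
  proof (rule Bochner_Integration.integrable_bound)
    show "integrable M (\<lambda>\<omega>. (norm (Y \<omega>))\<^sup>2 + (norm (Z \<omega>))\<^sup>2)"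
      using int by simp
    have "\<bar>Y \<omega> $ j * Z \<omega> $ j\<bar> \<le> (norm (Y \<omega>))\<^sup>2 + (norm (Z \<omega>))\<^sup>2" for \<omega>
    proof -
      have "\<bar>Y \<omega> $ j * Z \<omega> $ j\<bar> \<le> norm (Y \<omega>) * norm (Z \<omega>)"
        unfolding abs_mult by (intro mult_mono component_le_norm_cart) auto
      also have "\<dots> \<le> (norm (Y \<omega>))\<^sup>2 + (norm (Z \<omega>))\<^sup>2"
        using sum_squares_bound[of "norm (Y \<omega>)" "norm (Z \<omega>)"] mult_nonneg_nonneg[OF norm_ge_zero[of "Y \<omega>"] norm_ge_zero[of "Z \<omega>"]]
        by linarith
      finally show ?thesis .
    qed
    then show "AE \<omega> in M. norm (Y \<omega> $ j * Z \<omega> $ j) \<le> norm ((norm (Y \<omega>))\<^sup>2 + (norm (Z \<omega>))\<^sup>2)"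
      by simp
  qed (use comp in measurable)
  then show "integrable M (\<lambda>\<omega>. Y \<omega> \<bullet> Z \<omega>)"
    unfolding inner_vec_def by simp
  have zero: "(\<integral>\<omega>. Y \<omega> $ j * Z \<omega> $ j \<partial>M) = 0" for j
  proof -
    have "AE \<omega> in M. real_cond_exp M F (\<lambda>\<omega>. Z \<omega> $ j) \<omega> = 0"
      using mean by eventually_elim (auto simp: vec_cond_exp_def vec_eq_iff)
    then have "AE \<omega> in M. Y \<omega> $ j * real_cond_exp M F (\<lambda>\<omega>. Z \<omega> $ j) \<omega> = 0"
      by eventually_elim simp
    then show ?thesis
      using real_cond_exp_intg(2)[OF int_j comp(1,3)] integral_eq_zero_AE by metis
  qed
  show "(\<integral>\<omega>. Y \<omega> \<bullet> Z \<omega> \<partial>M) = 0"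
    unfolding inner_vec_def using int_j by (simp add: zero)
qed

text \<open>
  Nonnegative conditional expectations exist for every measurable function, so a bound on them
  implies integrability instead of presupposing it.
\<close>

lemma (in finite_measure_subalgebra) nn_cond_exp_bound_set_integral:
  fixes f :: "'a \<Rightarrow> real"
  assumes f [measurable]: "f \<in> borel_measurable M" and nonneg: "\<And>\<omega>. 0 \<le> f \<omega>" and "0 \<le> c"
    and bound: "AE \<omega> in M. nn_cond_exp M F (\<lambda>\<omega>. ennreal (f \<omega>)) \<omega> \<le> ennreal c"
  shows "integrable M f" and "B \<in> sets F \<Longrightarrow> (LINT \<omega>:B|M. f \<omega>) \<le> c * measure M B"
proof -
  have nn: "(\<integral>\<^sup>+\<omega>. ennreal (indicator B \<omega> * f \<omega>) \<partial>M) \<le> ennreal (c * measure M B)"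
    if B: "B \<in> sets F" for B
  proof -
    have B_M: "B \<in> sets M" using B subalg by (auto simp: subalgebra_def)
    have "(\<integral>\<^sup>+\<omega>. ennreal (indicator B \<omega> * f \<omega>) \<partial>M) = (\<integral>\<^sup>+\<omega>. indicator B \<omega> * ennreal (f \<omega>) \<partial>M)"
      by (intro nn_integral_cong) (auto simp: indicator_def)
    also have "\<dots> = (\<integral>\<^sup>+\<omega>. indicator B \<omega> * nn_cond_exp M F (\<lambda>\<omega>. ennreal (f \<omega>)) \<omega> \<partial>M)"
      using B by (intro nn_cond_exp_intg[symmetric]) auto
    also have "\<dots> \<le> (\<integral>\<^sup>+\<omega>. ennreal c * indicator B \<omega> \<partial>M)"
      using bound by (intro nn_integral_mono_AE, eventually_elim) (auto simp: indicator_def)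
    also have "\<dots> = ennreal (c * measure M B)"
      using B_M \<open>0 \<le> c\<close> by (simp add: nn_integral_cmult_indicator emeasure_eq_measure ennreal_mult)
    finally show ?thesis .
  qed
  have "(\<integral>\<^sup>+\<omega>. ennreal (norm (f \<omega>)) \<partial>M) = (\<integral>\<^sup>+\<omega>. ennreal (indicator (space F) \<omega> * f \<omega>) \<partial>M)"
    using subalg nonneg by (intro nn_integral_cong) (auto simp: subalgebra_def)
  also have "\<dots> < \<infinity>"
    using nn[OF sets.top] by (auto simp: less_top[symmetric] top_unique)
  finally show int: "integrable M f"
    by (intro integrableI_bounded) auto
  assume B: "B \<in> sets F"
  then have B_M: "B \<in> sets M" using subalg by (auto simp: subalgebra_def)
  have "integrable M (\<lambda>\<omega>. indicator B \<omega> * f \<omega>)"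
    using integrable_mult_indicator[OF B_M int] by simp
  then have "ennreal (LINT \<omega>:B|M. f \<omega>) \<le> ennreal (c * measure M B)"
    using nn[OF B] nonneg by (subst (asm) nn_integral_eq_integral) (auto simp: set_lebesgue_integral_def)
  then show "(LINT \<omega>:B|M. f \<omega>) \<le> c * measure M B"
    using \<open>0 \<le> c\<close> by (simp add: ennreal_le_iff)
qed

section \<open>Projected stochastic gradient iterates\<close>

text \<open>
  The squared distance \<open>V k\<close> to \<open>\<theta>star\<close> satisfies a recursion of Robbins-Monro type.
  Since \<open>\<theta>star\<close> is fixed by the noise-free step and projections are nonexpansive, the new distance is
  at most the norm of \<open>D k \<omega> - \<gamma> k *\<^sub>R \<beta> k \<omega>\<close>, where \<open>D k\<close> is the difference of the noise-free unprojected
  steps from \<open>\<theta> k\<close> and from \<open>\<theta>star\<close>. In the expansion of the square, the first term contracts up to second order in \<open>\<gamma> k\<close>,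
  the cross term integrates to zero over events of the history because \<open>D k\<close> is determined by
  that history, and the last term is bounded by the conditional variance.
\<close>

lemma (in prob_space) projected_stochastic_gradient_AE_tendsto:
  fixes \<theta> \<beta> :: "nat \<Rightarrow> 'a \<Rightarrow> real ^ 'p" and G :: "real ^ 'p \<Rightarrow> real ^ 'p" and \<gamma> :: "nat \<Rightarrow> real"
  assumes sub: "\<And>k. subalgebra M (F k)" and mono: "\<And>k. sets (F k) \<subseteq> sets (F (Suc k))"
    and S: "convex S" "closed S" "\<theta>star \<in> S"
    and G_meas [measurable]: "G \<in> borel_measurable borel"
    and G_mono: "\<And>s t. s \<in> S \<Longrightarrow> t \<in> S \<Longrightarrow> \<kappa> * (norm (s - t))\<^sup>2 \<le> (s - t) \<bullet> (G s - G t)"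
    and G_Lip: "\<And>s t. s \<in> S \<Longrightarrow> t \<in> S \<Longrightarrow> norm (G s - G t) \<le> R * norm (s - t)"
    and G_star: "\<And>t. t \<in> S \<Longrightarrow> 0 \<le> (t - \<theta>star) \<bullet> G \<theta>star"
    and \<open>0 < \<kappa>\<close>
    and adapted: "\<And>k. \<theta> k \<in> borel_measurable (F k)"
    and \<theta>_in: "\<And>k \<omega>. \<omega> \<in> space M \<Longrightarrow> \<theta> k \<omega> \<in> S"
    and step: "\<And>k \<omega>. \<omega> \<in> space M \<Longrightarrow>
      \<theta> (Suc k) \<omega> = closest_point S (\<theta> k \<omega> - \<gamma> k *\<^sub>R (G (\<theta> k \<omega>) + \<beta> k \<omega>))"
    and init: "integrable M (\<lambda>\<omega>. (norm (\<theta> 0 \<omega>))\<^sup>2)"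
    and \<beta>_meas: "\<And>k. \<beta> k \<in> borel_measurable M"
    and mean: "\<And>k. AE \<omega> in M. vec_cond_exp M (F k) (\<beta> k) \<omega> = 0"
    and var: "\<And>k. AE \<omega> in M. nn_cond_exp M (F k) (\<lambda>\<omega>. ennreal ((norm (\<beta> k \<omega>))\<^sup>2)) \<omega> \<le> ennreal (\<nu>\<^sup>2)"
    and gamma: "\<And>k. 0 \<le> \<gamma> k" "filterlim (\<lambda>n. \<Sum>k<n. \<gamma> k) at_top sequentially"
      "summable (\<lambda>k. (\<gamma> k)\<^sup>2)"
  shows "AE \<omega> in M. (\<lambda>k. \<theta> k \<omega>) \<longlonglongrightarrow> \<theta>star"
proof -
  define V where "V k \<omega> = (norm (\<theta> k \<omega> - \<theta>star))\<^sup>2" for k \<omega>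
  define D where "D k \<omega> = (\<theta> k \<omega> - \<theta>star) - \<gamma> k *\<^sub>R (G (\<theta> k \<omega>) - G \<theta>star)" for k \<omega>
  define q where "q k = 1 - 2 * \<kappa> * \<gamma> k + R\<^sup>2 * (\<gamma> k)\<^sup>2" for k
  have fin_sub: "finite_measure_subalgebra M (F k)" for k
    using sub finite_measure_axioms
    by (simp add: finite_measure_subalgebra_def finite_measure_subalgebra_axioms_def)
  have V_nonneg: "0 \<le> V k \<omega>" for k \<omega>
    by (simp add: V_def)
  note [measurable] = adapted
  have V_F: "V k \<in> borel_measurable (F k)" and D_F: "D k \<in> borel_measurable (F k)" for k
    unfolding V_def D_def by measurable
  note [measurable] = measurable_from_subalg[OF sub V_F] measurable_from_subalg[OF sub D_F]
  note [measurable] = D_F \<beta>_meas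
  have D_le: "(norm (D k \<omega>))\<^sup>2 \<le> q k * V k \<omega>" if "\<omega> \<in> space M" for k \<omega>
    unfolding D_def V_def q_def using that S(3) gamma(1)
    by (intro gradient_step_contraction G_mono G_Lip \<theta>_in)
  have V_Suc: "V (Suc k) \<omega> \<le> (norm (D k \<omega>))\<^sup>2 - 2 * \<gamma> k * (D k \<omega> \<bullet> \<beta> k \<omega>) + (\<gamma> k)\<^sup>2 * (norm (\<beta> k \<omega>))\<^sup>2"
    if w: "\<omega> \<in> space M" for k \<omega>
  proof -
    have "\<theta>star = closest_point S (\<theta>star - \<gamma> k *\<^sub>R G \<theta>star)"
      by (rule projected_gradient_fixed_point[symmetric]) (use S gamma(1) G_star in auto)
    then have "dist (\<theta> (Suc k) \<omega>) \<theta>star \<le>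
        dist (\<theta> k \<omega> - \<gamma> k *\<^sub>R (G (\<theta> k \<omega>) + \<beta> k \<omega>)) (\<theta>star - \<gamma> k *\<^sub>R G \<theta>star)"
      using closest_point_lipschitz[OF S(1,2)] S(3) step[OF w, of k] by (metis empty_iff)
    also have "\<dots> = norm (D k \<omega> - \<gamma> k *\<^sub>R \<beta> k \<omega>)"
      by (simp add: dist_norm D_def algebra_simps)
    finally have "V (Suc k) \<omega> \<le> (norm (D k \<omega> - \<gamma> k *\<^sub>R \<beta> k \<omega>))\<^sup>2"
      unfolding V_def dist_norm by (intro power_mono) auto
    then show ?thesis
      unfolding power2_norm_eq_inner by (simp add: inner_diff inner_commute power2_eq_square)
  qed
  have \<beta>_int: "integrable M (\<lambda>\<omega>. (norm (\<beta> k \<omega>))\<^sup>2)" for k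
    by (rule finite_measure_subalgebra.nn_cond_exp_bound_set_integral(1)[OF fin_sub _ _ _ var]) auto
  have D_int_if: "integrable M (\<lambda>\<omega>. (norm (D k \<omega>))\<^sup>2)" if "integrable M (V k)" for k
  proof (rule Bochner_Integration.integrable_bound)
    show "integrable M (\<lambda>\<omega>. q k * V k \<omega>)" using that by simp
    show "AE \<omega> in M. norm ((norm (D k \<omega>))\<^sup>2) \<le> norm (q k * V k \<omega>)"
      by (intro AE_I2) (metis D_le abs_ge_self abs_power2 order_trans real_norm_def)
  qed measurable
  have V_int: "integrable M (V k)" for k
  proof (induction k)
    case 0
    show ?case
    proof (rule Bochner_Integration.integrable_bound)
      show "integrable M (\<lambda>\<omega>. 2 * (norm (\<theta> 0 \<omega>))\<^sup>2 + 2 * (norm \<theta>star)\<^sup>2)"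
        using init by simp
      have "V 0 \<omega> \<le> 2 * (norm (\<theta> 0 \<omega>))\<^sup>2 + 2 * (norm \<theta>star)\<^sup>2" for \<omega>
      proof -
        have "V 0 \<omega> \<le> (norm (\<theta> 0 \<omega>) + norm \<theta>star)\<^sup>2"
          unfolding V_def by (intro power_mono norm_triangle_ineq4) simp
        also have "\<dots> \<le> 2 * (norm (\<theta> 0 \<omega>))\<^sup>2 + 2 * (norm \<theta>star)\<^sup>2"
          using sum_squares_bound[of "norm (\<theta> 0 \<omega>)" "norm \<theta>star"] by (simp add: power2_sum)
        finally show ?thesis .
      qed
      then show "AE \<omega> in M. norm (V 0 \<omega>) \<le> norm (2 * (norm (\<theta> 0 \<omega>))\<^sup>2 + 2 * (norm \<theta>star)\<^sup>2)"
        by (simp add: V_def)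
    qed measurable
  next
    case (Suc k)
    have D_int: "integrable M (\<lambda>\<omega>. (norm (D k \<omega>))\<^sup>2)"
      using D_int_if[OF Suc] .
    have "integrable M (\<lambda>\<omega>. D k \<omega> \<bullet> \<beta> k \<omega>)"
      by (rule sigma_finite_subalgebra.integral_inner_vec_cond_exp_zero(1)[OF
            finite_measure_subalgebra_is_sigma_finite[OF fin_sub] D_F \<beta>_meas D_int \<beta>_int mean])
    then have "integrable M (\<lambda>\<omega>. (norm (D k \<omega>))\<^sup>2 - 2 * \<gamma> k * (D k \<omega> \<bullet> \<beta> k \<omega>) + (\<gamma> k)\<^sup>2 * (norm (\<beta> k \<omega>))\<^sup>2)"
      using D_int \<beta>_int by simp
    then show ?case
    proof (rule Bochner_Integration.integrable_bound)
      show "AE \<omega> in M. norm (V (Suc k) \<omega>) \<le>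
          norm ((norm (D k \<omega>))\<^sup>2 - 2 * \<gamma> k * (D k \<omega> \<bullet> \<beta> k \<omega>) + (\<gamma> k)\<^sup>2 * (norm (\<beta> k \<omega>))\<^sup>2)"
      proof (rule AE_I2)
        fix \<omega> assume "\<omega> \<in> space M"
        moreover have "norm (V (Suc k) \<omega>) = V (Suc k) \<omega>" by (simp add: V_def)
        ultimately show "norm (V (Suc k) \<omega>) \<le>
            norm ((norm (D k \<omega>))\<^sup>2 - 2 * \<gamma> k * (D k \<omega> \<bullet> \<beta> k \<omega>) + (\<gamma> k)\<^sup>2 * (norm (\<beta> k \<omega>))\<^sup>2)"
          using V_Suc[of \<omega> k] by (metis abs_ge_self order_trans real_norm_def)
      qed
    qed measurable
  qed
  note D_int = D_int_if[OF V_int]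
  have "AE \<omega> in M. (\<lambda>k. V k \<omega>) \<longlonglongrightarrow> 0"
  proof (rule stochastic_approximation_AE_tendsto_zero[where F = F and a = "2 * \<kappa>" and b = "R\<^sup>2" and c = "\<nu>\<^sup>2" and \<gamma> = \<gamma>])
    fix k B assume B: "B \<in> sets (F k)"
    then have B_M [measurable]: "B \<in> sets M"
      using sub by (auto simp: subalgebra_def)
    have set_int: "set_integrable M B f" if "integrable M f" for f :: "'a \<Rightarrow> real"
      unfolding set_integrable_def using that B_M by (intro integrable_mult_indicator)
    \<comment> \<open>The restriction to \<open>B\<close> is absorbed into the factor that is measurable with respect to the history.\<close>
    let ?Y = "\<lambda>\<omega>. indicator B \<omega> *\<^sub>R D k \<omega>"
    have Y_F: "?Y \<in> borel_measurable (F k)"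
      using B by measurable
    have Y_int: "integrable M (\<lambda>\<omega>. (norm (?Y \<omega>))\<^sup>2)"
    proof (rule Bochner_Integration.integrable_bound[OF D_int[of k]])
      show "AE \<omega> in M. norm ((norm (?Y \<omega>))\<^sup>2) \<le> norm ((norm (D k \<omega>))\<^sup>2)"
        by (intro AE_I2) (auto simp: indicator_def)
    qed measurable
    note orth = sigma_finite_subalgebra.integral_inner_vec_cond_exp_zero[OF
        finite_measure_subalgebra_is_sigma_finite[OF fin_sub] _ \<beta>_meas _ \<beta>_int mean]
    have cross_int: "integrable M (\<lambda>\<omega>. D k \<omega> \<bullet> \<beta> k \<omega>)"
      by (rule orth(1)[OF D_F D_int])
    have cross: "(LINT \<omega>:B|M. D k \<omega> \<bullet> \<beta> k \<omega>) = 0"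
      using orth(2)[OF Y_F Y_int] by (simp add: set_lebesgue_integral_def)
    have "(LINT \<omega>:B|M. V (Suc k) \<omega>) \<le>
        (LINT \<omega>:B|M. (norm (D k \<omega>))\<^sup>2 - 2 * \<gamma> k * (D k \<omega> \<bullet> \<beta> k \<omega>) + (\<gamma> k)\<^sup>2 * (norm (\<beta> k \<omega>))\<^sup>2)"
      using V_Suc sets.sets_into_space[OF B_M] V_int D_int \<beta>_int cross_int
      by (intro set_integral_mono set_int) auto
    also have "\<dots> = (LINT \<omega>:B|M. (norm (D k \<omega>))\<^sup>2) - 2 * \<gamma> k * (LINT \<omega>:B|M. D k \<omega> \<bullet> \<beta> k \<omega>)
        + (\<gamma> k)\<^sup>2 * (LINT \<omega>:B|M. (norm (\<beta> k \<omega>))\<^sup>2)"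
      using D_int \<beta>_int cross_int
      by (subst set_integral_add(2) set_integral_diff(2) | simp add: set_int)+
    also have "\<dots> \<le> q k * (LINT \<omega>:B|M. V k \<omega>) + (\<gamma> k)\<^sup>2 * (\<nu>\<^sup>2 * prob B)"
    proof -
      have "(LINT \<omega>:B|M. (norm (D k \<omega>))\<^sup>2) \<le> (LINT \<omega>:B|M. q k * V k \<omega>)"
        using D_le sets.sets_into_space[OF B_M] V_int D_int
        by (intro set_integral_mono set_int) auto
      moreover have "(LINT \<omega>:B|M. (norm (\<beta> k \<omega>))\<^sup>2) \<le> \<nu>\<^sup>2 * prob B"
        by (rule finite_measure_subalgebra.nn_cond_exp_bound_set_integral(2)[OF fin_sub _ _ _ var B]) auto
      ultimately show ?thesis
        unfolding cross by (simp add: add_mono mult_left_mono)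
    qed
    finally show "(LINT \<omega>:B|M. V (Suc k) \<omega>) \<le>
        (1 - 2 * \<kappa> * \<gamma> k + R\<^sup>2 * (\<gamma> k)\<^sup>2) * (LINT \<omega>:B|M. V k \<omega>) + \<nu>\<^sup>2 * (\<gamma> k)\<^sup>2 * prob B"
      by (simp add: q_def mult.commute mult.left_commute)
  qed (use sub mono V_F V_int gamma \<open>0 < \<kappa>\<close> in \<open>auto simp: V_nonneg\<close>)
  then show ?thesis
  proof (rule AE_mp, intro AE_I2 impI)
    fix \<omega> assume "(\<lambda>k. V k \<omega>) \<longlonglongrightarrow> 0"
    then have "(\<lambda>k. sqrt (V k \<omega>)) \<longlonglongrightarrow> sqrt 0"
      by (rule tendsto_real_sqrt)
    then have "(\<lambda>k. norm (\<theta> k \<omega> - \<theta>star)) \<longlonglongrightarrow> 0"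
      unfolding V_def by (simp only: real_sqrt_abs abs_norm_cancel real_sqrt_zero)
    then have "(\<lambda>k. \<theta> k \<omega> - \<theta>star) \<longlonglongrightarrow> 0"
      by (rule tendsto_norm_zero_cancel)
    then show "(\<lambda>k. \<theta> k \<omega>) \<longlonglongrightarrow> \<theta>star"
      by (simp add: LIM_zero_iff)
  qed
qed

section \<open>The history of the algorithm as a filtration\<close>

lemma
  shows space_history_algebra: "space (history_algebra M N x0 th0 xs cs k) = space M"
    and sets_history_algebra: "sets (history_algebra M N x0 th0 xs cs k) = sigma_sets (space M)
     ({x0 i -` A \<inter> space M | i A. i \<in> N \<and> A \<in> sets borel} \<union>
      {th0 i -` A \<inter> space M | i A. i \<in> N \<and> A \<in> sets borel} \<union>
      {xs i t -` A \<inter> space M | i t A. i \<in> N \<and> t < k \<and> A \<in> sets borel} \<union>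
      {cs i t -` A \<inter> space M | i t A. i \<in> N \<and> t < k \<and> A \<in> sets borel})"
  unfolding history_algebra_def by (subst space_measure_of sets_measure_of; blast)+

lemma subalgebra_history_algebra:
  assumes "\<And>i. i \<in> N \<Longrightarrow> x0 i \<in> borel_measurable M" "\<And>i. i \<in> N \<Longrightarrow> th0 i \<in> borel_measurable M"
    and "\<And>i t. i \<in> N \<Longrightarrow> xs i t \<in> borel_measurable M" "\<And>i t. i \<in> N \<Longrightarrow> cs i t \<in> borel_measurable M"
  shows "subalgebra M (history_algebra M N x0 th0 xs cs k)"
  unfolding subalgebra_def space_history_algebra sets_history_algebra
  by (intro conjI refl sets.sigma_sets_subset Un_least; clarify; rule measurable_sets, rule assms; assumption)

lemma sets_history_algebra_mono:
  assumes "k \<le> l"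
  shows "sets (history_algebra M N x0 th0 xs cs k) \<subseteq> sets (history_algebra M N x0 th0 xs cs l)"
  unfolding sets_history_algebra by (intro sigma_sets_mono' Un_mono subset_refl; use order_less_le_trans[OF _ assms] in blast)

lemma measurable_history_algebra_initial:
  fixes th0 :: "nat \<Rightarrow> 'w \<Rightarrow> 'b::topological_space"
  assumes "i \<in> N"
  shows "th0 i \<in> borel_measurable (history_algebra M N x0 th0 xs cs k)"
proof (rule measurableI)
  fix A :: "'b set" assume "A \<in> sets borel"
  then have "th0 i -` A \<inter> space M \<in> {th0 i -` A \<inter> space M | i A. i \<in> N \<and> A \<in> sets borel}"
    using assms by blast
  then show "th0 i -` A \<inter> space (history_algebra M N x0 th0 xs cs k) \<in> sets (history_algebra M N x0 th0 xs cs k)"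
    unfolding space_history_algebra sets_history_algebra
    by (intro sigma_sets.Basic UnI1[OF UnI1[OF UnI2]])
qed simp

lemma measurable_history_algebra_sample:
  fixes cs :: "nat \<Rightarrow> nat \<Rightarrow> 'w \<Rightarrow> 'd::topological_space"
  assumes "i \<in> N" "t < k"
  shows "cs i t \<in> borel_measurable (history_algebra M N x0 th0 xs cs k)"
proof (rule measurableI)
  fix A :: "'d set" assume "A \<in> sets borel"
  then have "cs i t -` A \<inter> space M \<in> {cs i t -` A \<inter> space M | i t A. i \<in> N \<and> t < k \<and> A \<in> sets borel}"
    using assms by blast
  then show "cs i t -` A \<inter> space (history_algebra M N x0 th0 xs cs k) \<in> sets (history_algebra M N x0 th0 xs cs k)"
    unfolding space_history_algebra sets_history_algebra
    by (intro sigma_sets.Basic UnI2)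
qed simp

section \<open>The learning iterates\<close>

text \<open>
  Each agent is treated separately, with the histories of all agents as the filtration. An iterate is
  determined by its history because the noisy gradient \<open>gradient h (\<theta> i k \<omega>) + \<beta> i k \<omega>\<close> is the sampled
  gradient at \<open>\<theta> i k \<omega>\<close>, a measurable function of the previous iterate and the last sample.
\<close>

theorem proposition1:
  fixes M :: "'w measure"
    and m :: nat and N :: "nat set"
    and X :: "nat \<Rightarrow> (real ^ 'n) set" and \<Theta> :: "(real ^ 'p) set"
    and \<phi> :: "nat \<Rightarrow> real ^ 'n \<Rightarrow> real ^ 'p \<Rightarrow> real ^ 'd \<Rightarrow> real"
    and g :: "real ^ 'p \<Rightarrow> real ^ 'r \<Rightarrow> real"
    and \<xi> :: "'w \<Rightarrow> real ^ 'd" and chi :: "'w \<Rightarrow> real ^ 'r"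
    and f :: "nat \<Rightarrow> real ^ 'n \<Rightarrow> real ^ 'p \<Rightarrow> real" and h :: "real ^ 'p \<Rightarrow> real"
    and a :: "nat \<Rightarrow> nat \<Rightarrow> nat \<Rightarrow> real"
    and \<alpha> \<gamma> :: "nat \<Rightarrow> real"
    and \<xi>s :: "nat \<Rightarrow> nat \<Rightarrow> 'w \<Rightarrow> real ^ 'd" and chis :: "nat \<Rightarrow> nat \<Rightarrow> 'w \<Rightarrow> real ^ 'r"
    and x v w :: "nat \<Rightarrow> nat \<Rightarrow> 'w \<Rightarrow> real ^ 'n"
    and \<theta> \<beta> :: "nat \<Rightarrow> nat \<Rightarrow> 'w \<Rightarrow> real ^ 'p"
    and F :: "nat \<Rightarrow> 'w measure"
    and \<kappa> R\<^sub>\<theta> \<nu> \<nu>\<^sub>\<theta> :: real and \<theta>star :: "real ^ 'p"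
  assumes prob: "prob_space M"
    and m: "m \<ge> 1" and N: "N = {1..m}"
    and X_closed_convex: "\<And>i. i \<in> N \<Longrightarrow> closed (X i) \<and> convex (X i)"
    and Theta_nonempty: "\<Theta> \<noteq> {}" and Theta_closed: "closed \<Theta>" and Theta_convex: "convex \<Theta>"
    and xi_meas: "\<xi> \<in> borel_measurable M" and chi_meas: "chi \<in> borel_measurable M"
    and phi_meas: "\<And>i. i \<in> N \<Longrightarrow> (\<lambda>(y, t, s). \<phi> i y t s) \<in> borel_measurable borel"
    and phi_convex: "\<And>i t s. i \<in> N \<Longrightarrow> convex_on UNIV (\<lambda>y. \<phi> i y t s)"
    and phi_C1: "\<And>i t s. i \<in> N \<Longrightarrow> continuously_differentiable (\<lambda>y. \<phi> i y t s)"
    and phi_int: "\<And>i y t. i \<in> N \<Longrightarrow> integrable M (\<lambda>\<omega>. \<phi> i y t (\<xi> \<omega>))"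
    and f_def: "\<And>i y t. f i y t = (\<integral>\<omega>. \<phi> i y t (\<xi> \<omega>) \<partial>M)"
    and phi_grad_int: "\<And>i y t. i \<in> N \<Longrightarrow> integrable M (\<lambda>\<omega>. gradient (\<lambda>z. \<phi> i z t (\<xi> \<omega>)) y)"
    and f_grad: "\<And>i y t. i \<in> N \<Longrightarrow>
           GDERIV (\<lambda>z. f i z t) y :> (\<integral>\<omega>. gradient (\<lambda>z. \<phi> i z t (\<xi> \<omega>)) y \<partial>M)"
    and g_meas: "(\<lambda>(t, c). g t c) \<in> borel_measurable borel"
    and g_strongly_convex: "\<And>c. \<exists>\<mu>>0. strongly_convex_on UNIV \<mu> (\<lambda>t. g t c)"
    and g_C1: "\<And>c. continuously_differentiable (\<lambda>t. g t c)"
    and g_int: "\<And>t. integrable M (\<lambda>\<omega>. g t (chi \<omega>))"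
    and h_def: "\<And>t. h t = (\<integral>\<omega>. g t (chi \<omega>) \<partial>M)"
    and g_grad_int: "\<And>t. integrable M (\<lambda>\<omega>. gradient (\<lambda>t'. g t' (chi \<omega>)) t)"
    and h_grad: "\<And>t. GDERIV h t :> (\<integral>\<omega>. gradient (\<lambda>t'. g t' (chi \<omega>)) t \<partial>M)"
    and kappa: "\<kappa> > 0" and h_strongly_convex: "strongly_convex_on \<Theta> \<kappa> h"
    and h_grad_Lipschitz: "\<And>s t. s \<in> \<Theta> \<Longrightarrow> t \<in> \<Theta> \<Longrightarrow> norm (gradient h s - gradient h t) \<le> R\<^sub>\<theta> * norm (s - t)"
    and x0_meas: "\<And>i. i \<in> N \<Longrightarrow> x i 0 \<in> borel_measurable M"
    and th0_meas: "\<And>i. i \<in> N \<Longrightarrow> \<theta> i 0 \<in> borel_measurable M"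
    and x0_in: "\<And>i \<omega>. i \<in> N \<Longrightarrow> \<omega> \<in> space M \<Longrightarrow> x i 0 \<omega> \<in> X i"
    and th0_in: "\<And>i \<omega>. i \<in> N \<Longrightarrow> \<omega> \<in> space M \<Longrightarrow> \<theta> i 0 \<omega> \<in> \<Theta>"
    and xis_meas: "\<And>i k. i \<in> N \<Longrightarrow> \<xi>s i k \<in> borel_measurable M"
    and chis_meas: "\<And>i k. i \<in> N \<Longrightarrow> chis i k \<in> borel_measurable M"
    and a_nonneg: "\<And>i j k. i \<in> N \<Longrightarrow> j \<in> N \<Longrightarrow> a i j k \<ge> 0"
    and a_sum: "\<And>i k. i \<in> N \<Longrightarrow> (\<Sum>j\<in>N. a i j k) = 1"
    and alpha_pos: "\<And>k. \<alpha> k > 0" and gamma_pos: "\<And>k. \<gamma> k > 0"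
    and v_def: "\<And>i k \<omega>. i \<in> N \<Longrightarrow> \<omega> \<in> space M \<Longrightarrow> v i k \<omega> = (\<Sum>j\<in>N. a i j k *\<^sub>R x j k \<omega>)"
    and w_def: "\<And>i k \<omega>. i \<in> N \<Longrightarrow> \<omega> \<in> space M \<Longrightarrow>
           w i k \<omega> = gradient (\<lambda>y. \<phi> i y (\<theta> i k \<omega>) (\<xi>s i k \<omega>)) (v i k \<omega>)
                    - gradient (\<lambda>y. f i y (\<theta> i k \<omega>)) (v i k \<omega>)"
    and beta_def: "\<And>i k \<omega>. i \<in> N \<Longrightarrow> \<omega> \<in> space M \<Longrightarrow>
           \<beta> i k \<omega> = gradient (\<lambda>t. g t (chis i k \<omega>)) (\<theta> i k \<omega>) - gradient h (\<theta> i k \<omega>)"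
    and x_step: "\<And>i k \<omega>. i \<in> N \<Longrightarrow> \<omega> \<in> space M \<Longrightarrow>
           x i (Suc k) \<omega> = closest_point (X i)
             (v i k \<omega> - \<alpha> k *\<^sub>R (gradient (\<lambda>y. f i y (\<theta> i k \<omega>)) (v i k \<omega>) + w i k \<omega>))"
    and th_step: "\<And>i k \<omega>. i \<in> N \<Longrightarrow> \<omega> \<in> space M \<Longrightarrow>
           \<theta> i (Suc k) \<omega> = closest_point \<Theta>
             (\<theta> i k \<omega> - \<gamma> k *\<^sub>R (gradient h (\<theta> i k \<omega>) + \<beta> i k \<omega>))"
    and F_def: "\<And>k. F k = history_algebra M N (\<lambda>i. x i 0) (\<lambda>i. \<theta> i 0) \<xi>s chis k"
    and w_mean: "\<And>i k. i \<in> N \<Longrightarrow> AE \<omega> in M. vec_cond_exp M (F k) (w i k) \<omega> = 0"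
    and beta_mean: "\<And>i k. i \<in> N \<Longrightarrow> AE \<omega> in M. vec_cond_exp M (F k) (\<beta> i k) \<omega> = 0"
    and w_var: "\<And>i k. i \<in> N \<Longrightarrow>
           AE \<omega> in M. nn_cond_exp M (F k) (\<lambda>\<omega>. ennreal ((norm (w i k \<omega>))\<^sup>2)) \<omega> \<le> ennreal (\<nu>\<^sup>2)"
    and beta_var: "\<And>i k. i \<in> N \<Longrightarrow>
           AE \<omega> in M. nn_cond_exp M (F k) (\<lambda>\<omega>. ennreal ((norm (\<beta> i k \<omega>))\<^sup>2)) \<omega> \<le> ennreal (\<nu>\<^sub>\<theta>\<^sup>2)"
    and th0_sq: "\<And>i. i \<in> N \<Longrightarrow> integrable M (\<lambda>\<omega>. (norm (\<theta> i 0 \<omega>))\<^sup>2)"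
    and gamma_sum: "filterlim (\<lambda>K. \<Sum>k<K. \<gamma> k) at_top sequentially"
    and gamma_sq_sum: "summable (\<lambda>k. (\<gamma> k)\<^sup>2)"
    and thstar: "\<theta>star = arg_min_on h \<Theta>"
  shows "AE \<omega> in M. \<forall>i\<in>N. (\<lambda>k. \<theta> i k \<omega>) \<longlonglongrightarrow> \<theta>star"
proof -
  interpret prob_space M by (rule prob)
  have h_GDERIV: "GDERIV h t :> gradient h t" for t
    using h_grad gradient_eqI by metis
  have h_diff: "h differentiable (at t)" for t
    using h_GDERIV unfolding gderiv_def differentiable_def by blast
  have star_in: "\<theta>star \<in> \<Theta>" and star_min: "\<And>t. t \<in> \<Theta> \<Longrightarrow> h \<theta>star \<le> h t"
    unfolding thstar
    using strongly_convex_on_arg_min[OF h_strongly_convex kappa Theta_closed Theta_nonempty h_GDERIV] by auto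
  have h_cont: "continuous_on UNIV h"
    using h_diff differentiable_imp_continuous_within continuous_on_eq_continuous_within by blast
  have grad_g [measurable]: "(\<lambda>(t, c). gradient (\<lambda>t. g t c) t) \<in> borel_measurable borel"
    using g_meas g_C1 by (intro borel_measurable_gradient) (auto simp: continuously_differentiable_def)
  have grad_h [measurable]: "gradient h \<in> borel_measurable borel"
  proof -
    \<comment> \<open>The measurability lemma for gradients is applied to \<open>h\<close> with a dummy second argument.\<close>
    have "(\<lambda>p :: (real ^ 'p) \<times> real. h (fst p)) \<in> borel_measurable borel"
      using h_cont
      by (intro borel_measurable_continuous_onI continuous_on_compose2[OF h_cont] continuous_intros) auto
    then have "(\<lambda>(t :: real ^ 'p, c :: real). gradient (\<lambda>t. h t) t) \<in> borel_measurable borel"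
      using h_diff by (intro borel_measurable_gradient) (auto simp: split_beta')
    from measurable_compose[OF _ this, of "\<lambda>t. (t, 0)" borel] show ?thesis
      by (simp add: borel_measurable_continuous_onI continuous_intros)
  qed
  have sub: "subalgebra M (F k)" for k
    unfolding F_def using x0_meas th0_meas xis_meas chis_meas by (rule subalgebra_history_algebra)
  have mono: "sets (F k) \<subseteq> sets (F (Suc k))" for k
    unfolding F_def by (rule sets_history_algebra_mono) simp
  have space_F: "space (F k) = space M" for k
    unfolding F_def by (rule space_history_algebra)
  have conv: "AE \<omega> in M. (\<lambda>k. \<theta> i k \<omega>) \<longlonglongrightarrow> \<theta>star" if i: "i \<in> N" for i
  proof (rule projected_stochastic_gradient_AE_tendsto[where F = F and S = \<Theta> and G = "gradient h"
        and \<kappa> = \<kappa> and R = R\<^sub>\<theta> and \<gamma> = \<gamma> and \<beta> = "\<beta> i" and \<nu> = \<nu>\<^sub>\<theta>])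
    have grad_sample: "(\<lambda>\<omega>. gradient (\<lambda>t. g t (chis i k \<omega>)) (\<theta> i k \<omega>)) \<in> borel_measurable A"
      if "\<theta> i k \<in> borel_measurable A" "chis i k \<in> borel_measurable A" for k and A :: "'w measure"
      using measurable_compose[OF borel_measurable_Pair[OF that] grad_g] by simp
    show adapted: "\<theta> i k \<in> borel_measurable (F k)" for k
    proof (induction k)
      case 0
      show ?case
        unfolding F_def using measurable_history_algebra_initial[OF i, of "\<lambda>i. \<theta> i 0"] .
    next
      case (Suc k)
      have \<theta>_F [measurable]: "\<theta> i k \<in> borel_measurable (F (Suc k))"
        using Suc mono[of k] space_F by (auto simp: measurable_def)
      have "chis i k \<in> borel_measurable (F (Suc k))"
        unfolding F_def by (rule measurable_history_algebra_sample[OF i]) simp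
      note [measurable] = grad_sample[OF \<theta>_F this]
      have [measurable]: "closest_point \<Theta> \<in> borel_measurable borel"
        by (intro borel_measurable_continuous_onI continuous_on_closest_point
              Theta_convex Theta_closed Theta_nonempty)
      have "(\<lambda>\<omega>. closest_point \<Theta> (\<theta> i k \<omega> - \<gamma> k *\<^sub>R gradient (\<lambda>t. g t (chis i k \<omega>)) (\<theta> i k \<omega>)))
          \<in> borel_measurable (F (Suc k))"
        by measurable
      then show ?case
        by (subst measurable_cong[where g = "\<lambda>\<omega>. closest_point \<Theta>
              (\<theta> i k \<omega> - \<gamma> k *\<^sub>R gradient (\<lambda>t. g t (chis i k \<omega>)) (\<theta> i k \<omega>))"])
           (simp_all add: space_F th_step[OF i] beta_def[OF i])
    qed
    show "\<theta> i k \<omega> \<in> \<Theta>" if "\<omega> \<in> space M" for k \<omega>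
      using that th0_in[OF i] th_step[OF i] closest_point_in_set[OF Theta_closed Theta_nonempty]
      by (cases k) auto
    show "\<beta> i k \<in> borel_measurable M" for k
    proof -
      have \<theta>_M [measurable]: "\<theta> i k \<in> borel_measurable M"
        by (rule measurable_from_subalg[OF sub adapted])
      note [measurable] = grad_sample[OF \<theta>_M chis_meas[OF i]]
      have "(\<lambda>\<omega>. gradient (\<lambda>t. g t (chis i k \<omega>)) (\<theta> i k \<omega>) - gradient h (\<theta> i k \<omega>)) \<in> borel_measurable M"
        by measurable
      then show ?thesis
        by (subst measurable_cong[OF beta_def[OF i]])
    qed
    show "\<kappa> * (norm (s - t))\<^sup>2 \<le> (s - t) \<bullet> (gradient h s - gradient h t)" if "s \<in> \<Theta>" "t \<in> \<Theta>" for s t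
      using strongly_convex_on_gradient_monotone[OF h_strongly_convex h_GDERIV h_GDERIV that] .
    show "0 \<le> (t - \<theta>star) \<bullet> gradient h \<theta>star" if "t \<in> \<Theta>" for t
      using minimizer_variational_inequality[OF Theta_convex h_GDERIV star_in that star_min] .
    show "0 \<le> \<gamma> k" for k
      using gamma_pos[of k] by simp
  qed (fact sub mono Theta_convex Theta_closed star_in grad_h h_grad_Lipschitz kappa th_step[OF i]
        th0_sq[OF i] beta_mean[OF i] beta_var[OF i] gamma_sum gamma_sq_sum)+
  have "countable N"
    unfolding N by simp
  then show ?thesis
    using conv by (simp add: AE_ball_countable)
qed

end
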